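(* Let $q\geq 2$ be an integer and let $d\colon(\mathbb{R}^q)^3\to\mathbb{R}_+$ be the $3$-distance on $\mathbb{R}^q$ that carries $(x_1,x_2,x_3)$ into the diameter of a largest inner ball associated with $x_1,x_2,x_3$. Then its best constant is $K^*_3=\rho$, where $$\rho=\frac{1}{7}\sqrt{20+2\sqrt{2}},$$ and this value is not attained.
   Context: $\mathbb{R}_+=[0,+\infty[$. For a set $X$ with at least two elements, a $3$-distance on $X$ is a map $d\colon X^3\to\mathbb{R}_+$ such that: (i) $d(x_1,x_2,x_3)=0$ if and only if $x_1=x_2=x_3$; (ii) $d$ is invariant under any permutation of its arguments; (iii) $d(x_1,x_2,x_3)\leq\sum_{i=1}^3 d(x_1,x_2,x_3)_i^z$ for all $x_1,x_2,x_3,z\in X$, where $d(x_1,x_2,x_3)_i^z$ denotes the value obtained from $d(x_1,x_2,x_3)$ by replacing its $i$th argument by $z$. The best constant associated with a $3$-distance $d$ on $X$ is $$K^*_3=\sup\left\{\frac{d(x_1,x_2,x_3)}{\sum_{i=1}^3 d(x_1,x_2,x_3)_i^z}: x_1,x_2,x_3,z\in X,\ |\{x_1,x_2,x_3\}|\geq 2\right\}.$$ It is attained if the ratio equals $K^*_3$ for some $x_1,x_2,x_3,z\in X$ with $|\{x_1,x_2,x_3\}|\geq 2$. A (closed) Euclidean $q$-ball of radius $r>0$ centered at $c\in\mathbb{R}^q$ is $\{x\in\mathbb{R}^q:|x-c|\leq r\}$, where $|\cdot|$ is the Euclidean norm. Given points $x_1,\ldots,x_n\in\mathbb{R}^q$,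 a Euclidean $q$-ball $B$ is an inner ball associated with $x_1,\ldots,x_n$ if: (1) the interior of $B$ contains none of the points $x_1,\ldots,x_n$; and (2) two of the points $x_1,\ldots,x_n$ are the endpoints of a diameter of $B$. When all the points coincide, there is no such ball and the value of $d$ is $0$ by convention. *)

theory Defs
  imports "HOL-Analysis.Analysis"
begin

definition three_distance :: "'a set \<Rightarrow> ('a \<Rightarrow> 'a \<Rightarrow> 'a \<Rightarrow> real) \<Rightarrow> bool" where
  "three_distance X d \<longleftrightarrow>
     (\<exists>a\<in>X. \<exists>b\<in>X. a \<noteq> b) \<and>
     (\<forall>x1\<in>X. \<forall>x2\<in>X. \<forall>x3\<in>X. d x1 x2 x3 \<ge> 0) \<and>
     (\<forall>x1\<in>X. \<forall>x2\<in>X. \<forall>x3\<in>X. d x1 x2 x3 = 0 \<longleftrightarrow> x1 = x2 \<and> x2 = x3) \<and>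
     (\<forall>x1\<in>X. \<forall>x2\<in>X. \<forall>x3\<in>X.
        d x1 x3 x2 = d x1 x2 x3 \<and> d x2 x1 x3 = d x1 x2 x3 \<and> d x2 x3 x1 = d x1 x2 x3 \<and>
        d x3 x1 x2 = d x1 x2 x3 \<and> d x3 x2 x1 = d x1 x2 x3) \<and>
     (\<forall>x1\<in>X. \<forall>x2\<in>X. \<forall>x3\<in>X. \<forall>z\<in>X.
        d x1 x2 x3 \<le> d z x2 x3 + d x1 z x3 + d x1 x2 z)"

definition simplex_ratio ::
    "('a \<Rightarrow> 'a \<Rightarrow> 'a \<Rightarrow> real) \<Rightarrow> 'a \<Rightarrow> 'a \<Rightarrow> 'a \<Rightarrow> 'a \<Rightarrow> real" where
  "simplex_ratio d x1 x2 x3 z = d x1 x2 x3 / (d z x2 x3 + d x1 z x3 + d x1 x2 z)"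

(* For a 3-distance on X the denominators are positive and the ratios are at most 1,
   so this is the supremum of a nonempty bounded set of reals. *)
definition best_constant :: "'a set \<Rightarrow> ('a \<Rightarrow> 'a \<Rightarrow> 'a \<Rightarrow> real) \<Rightarrow> real" where
  "best_constant X d =
     Sup {simplex_ratio d x1 x2 x3 z | x1 x2 x3 z.
            x1 \<in> X \<and> x2 \<in> X \<and> x3 \<in> X \<and> z \<in> X \<and> card {x1, x2, x3} \<ge> 2}"

definition best_constant_attained :: "'a set \<Rightarrow> ('a \<Rightarrow> 'a \<Rightarrow> 'a \<Rightarrow> real) \<Rightarrow> bool" where
  "best_constant_attained X d \<longleftrightarrow>
     (\<exists>x1\<in>X. \<exists>x2\<in>X. \<exists>x3\<in>X. \<exists>z\<in>X.
        card {x1, x2, x3} \<ge> 2 \<and> simplex_ratio d x1 x2 x3 z = best_constant X d)"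

(* Both conditions depend only on the set P of the given points. *)
definition inner_ball :: "'a::euclidean_space set \<Rightarrow> 'a set \<Rightarrow> bool" where
  "inner_ball P B \<longleftrightarrow>
     (\<exists>c r. r > 0 \<and> B = cball c r \<and>
        interior B \<inter> P = {} \<and>
        (\<exists>a\<in>P. \<exists>b\<in>P. a \<in> sphere c r \<and> b \<in> sphere c r \<and> c = midpoint a b))"

(* The value is independent of the choice among the largest inner balls; a largest one
   exists as soon as the points do not all coincide, since finitely many pairs of points
   give finitely many inner balls, and the ball on a closest pair of distinct points is one. *)
definition inner_ball_distance :: "'a::euclidean_space \<Rightarrow> 'a \<Rightarrow> 'a \<Rightarrow> real" where
  "inner_ball_distance x1 x2 x3 =
     (if x1 = x2 \<and> x2 = x3 then 0
      else diameter (ARG_MAX diameter B. inner_ball {x1, x2, x3} B))"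

end

theory Submission
  imports Defs
begin

text \<open>
  A ball whose diameter is the segment \<open>ab\<close> avoids a point \<open>p\<close> in its interior
  exactly when the angle at \<open>p\<close> in the triangle \<open>abp\<close> is not obtuse.  Hence the value
  of \<^const>\<open>inner_ball_distance\<close> on a triangle is its longest side if the triangle has no obtuse
  angle, and its middle side otherwise.  The upper bound is argued with signs of inner products
  instead of coordinates, so that it covers a fourth point outside the plane of the triangle.

  For the upper bound, let \<open>D\<close> be the value on a triangle and \<open>S\<close> the sum of the three
  values obtained by replacing one vertex by \<open>z\<close>.  Some side \<open>xy\<close> has length \<open>D\<close>,
  and the angle at the third vertex \<open>w\<close> is not obtuse.  A pair of vertices seen from
  \<open>z\<close> under an angle that is not obtuse contributes at least its distance to \<open>S\<close>; a pair
  seen under an obtuse angle contributes at least the larger of its two distances to \<open>z\<close>,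
  hence at least half its own distance.  In all configurations but one, adding up such bounds gives
  \<open>S \<ge> 3/2 D\<close>, and the constant \<open>\<rho>\<close> exceeds \<open>2/3\<close>.  In the
  remaining configuration (up to exchanging \<open>x\<close> and \<open>y\<close>) the angles
  \<open>xzy\<close>, \<open>xzw\<close> and \<open>ywz\<close> are obtuse.  With
  \<open>a\<close>, \<open>b\<close>, \<open>c\<close> the distances of \<open>x\<close>, \<open>y\<close>, \<open>w\<close> to
  \<open>z\<close>, and \<open>e\<close> the distance from \<open>y\<close> to \<open>w\<close>, one has
  \<open>D\<^sup>2 \<le> (a + c)\<^sup>2 + e\<^sup>2\<close> because the angle at \<open>w\<close> in \<open>xyw\<close> is not obtuse,
  \<open>c\<^sup>2 + e\<^sup>2 < b\<^sup>2\<close> because the one in \<open>ywz\<close> is, and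
  \<open>S \<ge> max a b + a + max c e\<close>.  This leaves an inequality between real numbers
  (\<open>extremal_inequality\<close>), in which the strictness of the second relation makes the bound
  strict.  So the constant is never attained, and it is below 1, which gives the simplex inequality.

  Equality would force \<open>c = e\<close> and \<open>a = b = sqrt 2 * c\<close>, with \<open>z\<close> between \<open>x\<close> and \<open>w\<close>
  and right angles at \<open>w\<close> in both \<open>xyw\<close> and \<open>ywz\<close>.  In that limiting shape
  the angle in \<open>ywz\<close> is not obtuse; lifting \<open>x\<close> and \<open>w\<close> slightly makes it obtuse
  while keeping the right angle of \<open>xyw\<close>, and the ratios then tend to the constant
  (\<open>ratio_near_extremal\<close>, \<open>ratio_limit\<close>).
\<close>

section \<open>Inner balls as pairs of points\<close>

text \<open>Thales: \<open>p\<close> is nearer to the midpoint than the endpoints are iff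
  \<open>|(a - p) + (b - p)| < |(a - p) - (b - p)|\<close>.\<close>

lemma mem_ball_diameter_iff:
  fixes a b p :: "'a::euclidean_space"
  shows "p \<in> ball (midpoint a b) (dist a b / 2) \<longleftrightarrow> inner (a - p) (b - p) < 0"
proof -
  have "p \<in> ball (midpoint a b) (dist a b / 2) \<longleftrightarrow> (norm ((a - p) + (b - p))) < norm ((a - p) - (b - p))"
  proof -
    have "dist (midpoint a b) p = norm ((a - p) + (b - p)) / 2"
    proof -
      have "midpoint a b - p = (1/2) *\<^sub>R ((a - p) + (b - p))"
        by (simp add: midpoint_def algebra_simps flip: scaleR_add_left)
      then show ?thesis by (simp add: dist_norm)
    qed
    then show ?thesis by (simp add: dist_norm)
  qed
  also have "\<dots> \<longleftrightarrow> (norm ((a - p) + (b - p)))\<^sup>2 < (norm ((a - p) - (b - p)))\<^sup>2"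
    by (meson norm_ge_zero power2_less_imp_less power_strict_mono zero_less_numeral)
  also have "\<dots> \<longleftrightarrow> inner (a - p) (b - p) < 0"
    unfolding power2_norm_eq_inner
    by (simp only: inner_add_left inner_add_right inner_diff_left inner_diff_right)
       (simp add: inner_commute, linarith)
  finally show ?thesis .
qed

text \<open>The pairs of points that span an inner ball.  Only points of \<open>P\<close> are tested, and an endpoint
  of the diameter passes the test with inner product 0.\<close>

definition diametral :: "'a::euclidean_space set \<Rightarrow> 'a \<Rightarrow> 'a \<Rightarrow> bool" where
  "diametral P a b \<longleftrightarrow> a \<in> P \<and> b \<in> P \<and> a \<noteq> b \<and> (\<forall>p\<in>P. 0 \<le> inner (a - p) (b - p))"

lemma inner_ball_iff_diametral:
  "inner_ball P B \<longleftrightarrow> (\<exists>a b. diametral P a b \<and> B = cball (midpoint a b) (dist a b / 2))"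
proof
  assume "inner_ball P B"
  then obtain c r a b where *: "r > 0" "B = cball c r" "interior B \<inter> P = {}"
    "a \<in> P" "b \<in> P" "a \<in> sphere c r" "c = midpoint a b"
    unfolding inner_ball_def by blast
  have r: "r = dist a b / 2"
    using * by (simp add: dist_midpoint)
  have "diametral P a b"
    unfolding diametral_def
  proof (intro conjI ballI)
    show "a \<noteq> b" using r \<open>r > 0\<close> by auto
    fix p assume "p \<in> P"
    then have "p \<notin> ball (midpoint a b) (dist a b / 2)" using * r by auto
    then show "0 \<le> inner (a - p) (b - p)" unfolding mem_ball_diameter_iff by simp
  qed (use * in auto)
  then show "\<exists>a b. diametral P a b \<and> B = cball (midpoint a b) (dist a b / 2)"
    using * r by blast
next
  assume "\<exists>a b. diametral P a b \<and> B = cball (midpoint a b) (dist a b / 2)"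
  then obtain a b where ab: "diametral P a b" and B: "B = cball (midpoint a b) (dist a b / 2)"
    by blast
  have "interior B \<inter> P = {}"
    using ab unfolding B diametral_def interior_cball
    by (auto simp del: mem_ball simp: mem_ball_diameter_iff)
  then show "inner_ball P B"
    unfolding inner_ball_def using ab B
    by (intro exI[of _ "midpoint a b"] exI[of _ "dist a b / 2"] conjI bexI[of _ a] bexI[of _ b])
       (auto simp: diametral_def dist_midpoint)
qed

text \<open>A closest pair of distinct points works: a point inside its ball would be closer to an
  endpoint.\<close>

lemma exists_diametral:
  assumes "finite P" "p \<in> P" "q \<in> P" "p \<noteq> q"
  shows "\<exists>a b. diametral P a b"
proof -
  let ?Q = "{(a, b). a \<in> P \<and> b \<in> P \<and> a \<noteq> b}"
  have "finite ?Q" by (rule finite_subset[of _ "P \<times> P"]) (use assms in auto)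
  moreover have "?Q \<noteq> {}" using assms by auto
  ultimately obtain x where x: "x \<in> ?Q"
    and min: "\<And>y. y \<in> ?Q \<Longrightarrow> dist (fst x) (snd x) \<le> dist (fst y) (snd y)"
    using arg_min_if_finite(1)[of ?Q "\<lambda>y. dist (fst y) (snd y)"]
      arg_min_least[of ?Q _ "\<lambda>y. dist (fst y) (snd y)"] by simp
  obtain a b where ab: "x = (a, b)" by fastforce
  have "diametral P a b"
    unfolding diametral_def
  proof (intro conjI ballI)
    fix p assume "p \<in> P"
    show "0 \<le> inner (a - p) (b - p)"
    proof (rule ccontr)
      assume neg: "\<not> ?thesis"
      then have "p \<noteq> a" by auto
      then have "dist a b \<le> dist a p" using min[of "(a, p)"] x ab \<open>p \<in> P\<close> by auto
      then have le: "(norm (a - b))\<^sup>2 \<le> (norm (a - p))\<^sup>2"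
        by (simp add: dist_norm)
      have "(norm (a - b))\<^sup>2 = (norm (a - p))\<^sup>2 + (norm (b - p))\<^sup>2 - 2 * inner (a - p) (b - p)"
        unfolding power2_norm_eq_inner
        by (simp add: inner_diff_left inner_diff_right inner_commute)
      moreover have "(norm (b - p))\<^sup>2 \<ge> 0" by simp
      ultimately show False using le neg by linarith
    qed
  qed (use x ab in auto)
  then show ?thesis by blast
qed

text \<open>The maximum of the diameters is attained because a finite set has finitely many pairs; so the
  choice made by \<^const>\<open>arg_max\<close> is indeed a largest inner ball.\<close>

lemma inner_ball_distance_maximal:
  assumes "\<not> (x = y \<and> y = z)"
  shows "\<exists>a b. diametral {x, y, z} a b \<and> inner_ball_distance x y z = dist a b \<and>
    (\<forall>a' b'. diametral {x, y, z} a' b' \<longrightarrow> dist a' b' \<le> dist a b)"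
proof -
  let ?P = "{x, y, z}"
  let ?Q = "{(a, b). diametral ?P a b}"
  have "finite ?Q" by (rule finite_subset[of _ "?P \<times> ?P"]) (auto simp: diametral_def)
  moreover obtain p q where pq: "p \<in> ?P" "q \<in> ?P" "p \<noteq> q" using assms by auto
  have "?Q \<noteq> {}" using exists_diametral[OF _ pq] by auto
  ultimately obtain u where u: "u \<in> ?Q"
    and max: "\<And>p. p \<in> ?Q \<Longrightarrow> dist (fst p) (snd p) \<le> dist (fst u) (snd u)"
    using arg_min_if_finite(1)[of ?Q "\<lambda>p. - dist (fst p) (snd p)"]
      arg_min_least[of ?Q _ "\<lambda>p. - dist (fst p) (snd p)"] by simp
  obtain a b where ab: "u = (a, b)" by fastforce
  have diam: "diameter (cball (midpoint a b) (dist a b / 2)) = dist a b" for a b :: 'a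
    by (simp add: diameter_cball)
  have le: "diameter B \<le> dist a b" if "inner_ball ?P B" for B
    using that max ab unfolding inner_ball_iff_diametral by (auto simp: diam)
  have ib: "inner_ball ?P (cball (midpoint a b) (dist a b / 2))"
    using u ab unfolding inner_ball_iff_diametral by blast
  have "diameter (ARG_MAX diameter B. inner_ball ?P B) = dist a b"
  proof (rule arg_maxI[of "inner_ball ?P" _ diameter "\<lambda>B. diameter B = dist a b"])
    show "inner_ball ?P (cball (midpoint a b) (dist a b / 2))" by (rule ib)
    fix B assume "inner_ball ?P B"
    then show "\<not> diameter (cball (midpoint a b) (dist a b / 2)) < diameter B"
      using le[of B] by (simp add: diam)
    assume "\<forall>C. inner_ball ?P C \<longrightarrow> \<not> diameter B < diameter C"
    then show "diameter B = dist a b"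
      using ib le[OF \<open>inner_ball ?P B\<close>] by (metis diam order_le_less)
  qed
  then have D: "inner_ball_distance x y z = dist a b"
    using assms unfolding inner_ball_distance_def by (simp only: if_False)
  have diametral: "diametral ?P a b" using u ab by simp
  have maximal: "dist a' b' \<le> dist a b" if "diametral ?P a' b'" for a' b'
    using max[of "(a', b')"] that ab by simp
  show ?thesis
    by (intro exI[of _ a] exI[of _ b] conjI allI impI diametral D maximal)
qed

lemma inner_ball_distance_cases:
  assumes "\<not> (x = y \<and> y = z)"
  obtains a b where "diametral {x, y, z} a b" "inner_ball_distance x y z = dist a b"
  using inner_ball_distance_maximal[OF assms] by (elim exE conjE)

lemma diametral_dist_le_inner_ball_distance:
  assumes "diametral {x, y, z} a b"
  shows "dist a b \<le> inner_ball_distance x y z"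
proof -
  have "\<not> (x = y \<and> y = z)" using assms unfolding diametral_def by blast
  from inner_ball_distance_maximal[OF this] show ?thesis using assms by (elim exE conjE) simp
qed

section \<open>The value on a triangle\<close>

lemma inner_ball_distance_cong:
  "{x, y, z} = {x', y', z'} \<Longrightarrow> inner_ball_distance x y z = inner_ball_distance x' y' z'"
proof -
  assume eq: "{x, y, z} = {x', y', z'}"
  have "x = y \<and> y = z \<longleftrightarrow> (\<forall>u\<in>{x, y, z}. \<forall>v\<in>{x, y, z}. u = v)" by auto
  also have "\<dots> \<longleftrightarrow> x' = y' \<and> y' = z'" unfolding eq by auto
  finally show ?thesis unfolding inner_ball_distance_def eq by simp
qed

lemma inner_ball_distance_swap12: "inner_ball_distance y x z = inner_ball_distance x y z"
  and inner_ball_distance_swap23: "inner_ball_distance x z y = inner_ball_distance x y z"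
  by (rule inner_ball_distance_cong; auto)+

lemma inner_ball_distance_nonneg: "0 \<le> inner_ball_distance x y z"
proof (cases "x = y \<and> y = z")
  case True
  then show ?thesis by (simp add: inner_ball_distance_def)
next
  case False
  then obtain a b where "diametral {x, y, z} a b" "inner_ball_distance x y z = dist a b"
    by (rule inner_ball_distance_cases)
  then show ?thesis by simp
qed

lemma inner_ball_distance_eq_0_iff: "inner_ball_distance x y z = 0 \<longleftrightarrow> x = y \<and> y = z"
proof (cases "x = y \<and> y = z")
  case True
  then show ?thesis by (simp add: inner_ball_distance_def)
next
  case False
  then obtain a b where "diametral {x, y, z} a b" "inner_ball_distance x y z = dist a b"
    by (rule inner_ball_distance_cases)
  moreover from this have "a \<noteq> b" by (simp only: diametral_def) simp
  ultimately show ?thesis using False by simp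
qed

lemma dist_le_inner_ball_distance:
  assumes "0 \<le> inner (x - z) (y - z)"
  shows "dist x y \<le> inner_ball_distance x y z"
proof (cases "x = y")
  case True
  then show ?thesis by (simp add: inner_ball_distance_nonneg)
next
  case False
  then have "diametral {x, y, z} x y" using assms by (auto simp: diametral_def)
  then show ?thesis by (rule diametral_dist_le_inner_ball_distance)
qed

text \<open>A triangle has at most one angle that is not acute: two inner products at different vertices
  add up to the square of a side.\<close>

lemma inner_vertex_add:
  fixes x y z :: "'a::real_inner"
  shows "inner (x - y) (z - y) + inner (x - z) (y - z) = (dist y z)\<^sup>2"
  unfolding dist_norm power2_norm_eq_inner
  by (simp add: inner_diff_left inner_diff_right inner_commute)

lemma cosine_rule:
  fixes x y z :: "'a::real_inner"
  shows "(dist x y)\<^sup>2 = (dist x z)\<^sup>2 + (dist y z)\<^sup>2 - 2 * inner (x - z) (y - z)"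
  unfolding dist_norm power2_norm_eq_inner
  by (simp add: inner_diff_left inner_diff_right inner_commute)

text \<open>The sides at a vertex with no acute angle are opposite to the two other angles, which cannot be
  obtuse.\<close>

lemma max_dist_le_inner_ball_distance:
  assumes "inner (x - z) (y - z) \<le> 0"
  shows "max (dist x z) (dist y z) \<le> inner_ball_distance x y z"
proof -
  have "0 \<le> inner (x - y) (z - y)" "0 \<le> inner (y - x) (z - x)"
    using inner_vertex_add[of x y z] inner_vertex_add[of y x z] assms
      zero_le_power2[of "dist y z"] zero_le_power2[of "dist x z"] inner_commute[of "y - z" "x - z"]
    by linarith+
  from this[THEN dist_le_inner_ball_distance] show ?thesis
    by (metis inner_ball_distance_swap12 inner_ball_distance_swap23 max.bounded_iff)
qed

text \<open>The longest side does not count here, since it is the one opposite to the obtuse angle.\<close>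

lemma inner_ball_distance_obtuse:
  assumes "inner (x - z) (y - z) < 0"
  shows "inner_ball_distance x y z = max (dist x z) (dist y z)"
proof (rule antisym)
  have "\<not> (x = y \<and> y = z)" using assms by auto
  then obtain a b where "diametral {x, y, z} a b" "inner_ball_distance x y z = dist a b"
    by (rule inner_ball_distance_cases)
  moreover have "\<not> (0 \<le> inner (x - z) (y - z))" "\<not> (0 \<le> inner (y - z) (x - z))"
    using assms by (simp_all add: inner_commute)
  ultimately show "inner_ball_distance x y z \<le> max (dist x z) (dist y z)"
    by (auto simp: diametral_def dist_commute)
qed (use max_dist_le_inner_ball_distance[of x z y] assms in simp)

lemma half_dist_le_inner_ball_distance: "dist x y / 2 \<le> inner_ball_distance x y z"
proof (cases "0 \<le> inner (x - z) (y - z)")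
  case True
  from dist_le_inner_ball_distance[OF this] show ?thesis
    using zero_le_dist[of x y] by linarith
next
  case False
  then have "max (dist x z) (dist y z) \<le> inner_ball_distance x y z"
    by (intro max_dist_le_inner_ball_distance) simp
  then show ?thesis using dist_triangle2[of x y z] by linarith
qed

section \<open>The extremal inequality\<close>

lemma sqrt_2_bounds: "(0::real) < sqrt 2" "sqrt 2 * sqrt 2 = (2::real)" "1.4 < (sqrt 2::real)" "sqrt 2 < (1.5::real)"
  by (simp, simp, rule real_less_rsqrt, simp add: power2_eq_square, rule real_less_lsqrt, simp_all add: power2_eq_square)

text \<open>The number \<open>(10 - sqrt 2) / 4\<close> is the inverse square of the constant.  In the two lemmas
  below, the difference of the two sides is a concave quadratic in \<open>a\<close>, so on \<open>[0, t]\<close> it is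
  bounded below by its values at \<open>a = 0\<close> and \<open>a = t\<close>; in each lemma the value at
  \<open>a = t\<close> vanishes for \<open>t = sqrt 2 * m\<close>, the extremal shape.  The two lemmas estimate
  \<open>(a + c)\<^sup>2 + e\<^sup>2\<close> subject to \<open>c, e \<le> m\<close> and \<open>c\<^sup>2 + e\<^sup>2 \<le> t\<^sup>2\<close> in different ways: if
  \<open>t\<close> is large, by setting \<open>c = e = m\<close>; otherwise by \<open>c \<le> m\<close> in the mixed term
  and by \<open>t\<^sup>2\<close> in the sum of squares.\<close>

lemma extremal_inequality_steep:
  fixes a m t :: real
  defines "s \<equiv> sqrt 2"
  assumes "0 \<le> a" "a \<le> t" "0 \<le> m" "s * m < t"
  shows "(10 - s) * ((a + m)\<^sup>2 + m\<^sup>2) < 4 * (t + a + m)\<^sup>2"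
proof -
  have s: "0 < s" "s * s = 2" "1.4 < s" "s < 1.5" using sqrt_2_bounds by (simp_all add: s_def)
  have t: "0 < t" using assms s by (smt (verit) mult_nonneg_nonneg)
  define q where "q x = 4 * (t + x + m)\<^sup>2 - (10 - s) * ((x + m)\<^sup>2 + m\<^sup>2)" for x
  \<comment> \<open>the terms with factor \<open>s * s - 2\<close>, here and below, vanish; they make the identities valid for every \<open>s\<close>\<close>
  have "q 0 = 4 * ((t - s * m) * (t + s * m)) + 8 * m * (t - s * m) + (10 * s - 8) * m\<^sup>2
      + 4 * (s * s - 2) * m\<^sup>2"
    unfolding q_def by algebra
  moreover have "0 < (t - s * m) * (t + s * m)"
    using assms s t by (intro mult_pos_pos add_pos_nonneg) auto
  moreover have "0 \<le> 8 * m * (t - s * m)" "0 \<le> (10 * s - 8) * m\<^sup>2"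
    using assms s by auto
  ultimately have q0: "0 < q 0" using s(2) by simp
  have "q t = (t - s * m) * ((6 + s) * t + (8 * s - 2) * m)
      + (s * s - 2) * (t * m + 8 * m\<^sup>2)"
    unfolding q_def by algebra
  moreover have "0 < (t - s * m) * ((6 + s) * t + (8 * s - 2) * m)"
    using assms s t by (intro mult_pos_pos add_pos_nonneg) auto
  ultimately have q1: "0 < q t" using s(2) by simp
  \<comment> \<open>the interpolation defect of a quadratic with leading coefficient \<open>s - 6\<close>\<close>
  have "t * q a = (t - a) * q 0 + a * q t + (6 - s) * (a * (t - a) * t)"
    unfolding q_def by algebra
  moreover have "0 \<le> (6 - s) * (a * (t - a) * t)" "0 \<le> a * q t" "0 \<le> (t - a) * q 0"
    using assms s t q0 q1 by auto
  moreover have "0 < a * q t \<or> 0 < (t - a) * q 0"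
    using assms t q0 q1 by (cases "a = 0") auto
  ultimately have "0 < t * q a" by linarith
  then show ?thesis using t by (simp add: q_def zero_less_mult_iff)
qed

lemma extremal_inequality_flat:
  fixes a m t :: real
  defines "s \<equiv> sqrt 2"
  assumes "0 \<le> a" "a \<le> t" "0 < t" "t \<le> s * m"
  shows "(10 - s) * (a\<^sup>2 + 2 * a * m + t\<^sup>2) \<le> 4 * (t + a + m)\<^sup>2"
proof -
  have s: "0 < s" "s * s = 2" "1.4 < s" "s < 1.5" using sqrt_2_bounds by (simp_all add: s_def)
  have m: "0 < m" using assms s by (smt (verit) mult_nonneg_nonpos)
  define r where "r x = 4 * (t + x + m)\<^sup>2 - (10 - s) * (x\<^sup>2 + 2 * x * m + t\<^sup>2)" for x
  have tt: "0 \<le> (s * m - t) * (s * m + t)" "0 \<le> (s * m - t) * t"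
    using assms s m by (auto intro!: mult_nonneg_nonneg)
  have "r 0 = 2 * ((s * m - t) * (s * m + t)) + 4 * s * ((s * m - t) * t) + (5 * s - 4) * t\<^sup>2
      - (s * s - 2) * (2 * m\<^sup>2 + 4 * t * m)"
    by (simp add: r_def power2_eq_square algebra_simps)
  moreover have "0 \<le> 4 * s * ((s * m - t) * t)" "0 \<le> (5 * s - 4) * t\<^sup>2"
    using tt s by auto
  ultimately have r0: "0 \<le> r 0" using tt s(2) by simp
  have "r t = (4 - 2 * s) * ((s * m - t) * (s * m + t) + (s * m - t) * m)
      + (s * s - 2) * ((2 * s - 2) * m\<^sup>2)"
    unfolding r_def by algebra
  moreover have "0 \<le> (4 - 2 * s) * ((s * m - t) * (s * m + t) + (s * m - t) * m)"
    using tt(1) s assms m by (intro mult_nonneg_nonneg add_nonneg_nonneg) auto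
  ultimately have r1: "0 \<le> r t" using s(2) by simp
  \<comment> \<open>the interpolation defect of a quadratic with leading coefficient \<open>s - 6\<close>\<close>
  have "t * r a = (t - a) * r 0 + a * r t + (6 - s) * (a * (t - a) * t)"
    by (simp add: r_def power2_eq_square algebra_simps)
  moreover have "0 \<le> (6 - s) * (a * (t - a) * t)" "0 \<le> a * r t" "0 \<le> (t - a) * r 0"
    using assms s r0 r1 by auto
  ultimately have "0 \<le> t * r a" by linarith
  then show ?thesis using assms by (simp add: r_def zero_le_mult_iff)
qed

lemma extremal_inequality:
  fixes a c e m t :: real
  assumes "0 \<le> a" "a \<le> t" "0 \<le> c" "c \<le> m" "0 \<le> e" "e \<le> m" "c\<^sup>2 + e\<^sup>2 < t\<^sup>2"
  shows "(10 - sqrt 2) * ((a + c)\<^sup>2 + e\<^sup>2) < 4 * (t + a + m)\<^sup>2"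
proof (cases "sqrt 2 * m < t")
  case True
  have "(a + c)\<^sup>2 + e\<^sup>2 \<le> (a + m)\<^sup>2 + m\<^sup>2"
    using assms by (intro add_mono power_mono) auto
  then have "(10 - sqrt 2) * ((a + c)\<^sup>2 + e\<^sup>2) \<le> (10 - sqrt 2) * ((a + m)\<^sup>2 + m\<^sup>2)"
    using sqrt_2_bounds by (intro mult_left_mono) auto
  also have "\<dots> < 4 * (t + a + m)\<^sup>2"
    using assms True by (intro extremal_inequality_steep) auto
  finally show ?thesis .
next
  case False
  have "t \<noteq> 0" using assms(7) by (auto simp: not_sum_power2_lt_zero)
  then have "0 < t" using assms by linarith
  have "(a + c)\<^sup>2 + e\<^sup>2 = a\<^sup>2 + 2 * a * c + (c\<^sup>2 + e\<^sup>2)" by algebra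
  also have "\<dots> < a\<^sup>2 + 2 * a * m + t\<^sup>2"
    using assms by (intro add_le_less_mono add_left_mono mult_left_mono) auto
  finally have "(10 - sqrt 2) * ((a + c)\<^sup>2 + e\<^sup>2) < (10 - sqrt 2) * (a\<^sup>2 + 2 * a * m + t\<^sup>2)"
    using sqrt_2_bounds by (intro mult_strict_left_mono) auto
  also have "\<dots> \<le> 4 * (t + a + m)\<^sup>2"
    using assms False \<open>0 < t\<close> by (intro extremal_inequality_flat) auto
  finally show ?thesis .
qed

definition inner_ball_constant :: real where
  "inner_ball_constant = (1 / 7) * sqrt (20 + 2 * sqrt 2)"

lemma inner_ball_constant_sq: "inner_ball_constant\<^sup>2 * (10 - sqrt 2) = 4"
proof -
  have "inner_ball_constant\<^sup>2 = (20 + 2 * sqrt 2) / 49"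
    by (simp add: inner_ball_constant_def power_mult_distrib power_divide)
  moreover have "(20 + 2 * sqrt 2) * (10 - sqrt 2) = (196::real)"
    using sqrt_2_bounds(2) by (simp add: algebra_simps)
  ultimately show ?thesis by (simp only: times_divide_eq_left)
qed

lemma inner_ball_constant_bounds: "2/3 < inner_ball_constant" "inner_ball_constant < 1"
proof -
  have sq: "inner_ball_constant\<^sup>2 = (20 + 2 * sqrt 2) / 49"
    by (simp add: inner_ball_constant_def power_mult_distrib power_divide)
  have "(2/3)\<^sup>2 < inner_ball_constant\<^sup>2" "inner_ball_constant\<^sup>2 < 1\<^sup>2"
    unfolding sq using sqrt_2_bounds(3,4) by (simp_all add: power2_eq_square field_simps)
  moreover have "0 \<le> inner_ball_constant" by (simp add: inner_ball_constant_def)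
  ultimately show "2/3 < inner_ball_constant" "inner_ball_constant < 1"
    by (meson power2_less_imp_less zero_le_one)+
qed

lemma less_constant_mult_of_three_halves:
  assumes "0 < D" "3/2 * D \<le> S"
  shows "D < inner_ball_constant * S"
proof -
  have "D \<le> 2/3 * S" using assms(2) by simp
  also have "\<dots> < inner_ball_constant * S"
    using inner_ball_constant_bounds(1) assms by (intro mult_strict_right_mono) linarith+
  finally show ?thesis .
qed

section \<open>The bound for four points\<close>

text \<open>The configuration that determines the constant.  If the angle at \<open>w\<close> in \<open>ywz\<close> is not
  obtuse, then the value there is at least \<open>dist y z\<close>, so that the sum is again at least \<open>3/2 * dist x y\<close>.\<close>

lemma critical_case:
  fixes x y w z :: "'a::euclidean_space"
  assumes "0 \<le> inner (x - w) (y - w)" "x \<noteq> y"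
    and xy: "inner (x - z) (y - z) \<le> 0" and xw: "inner (x - z) (w - z) \<le> 0"
  shows "dist x y < inner_ball_constant *
    (inner_ball_distance x y z + inner_ball_distance x w z + inner_ball_distance y w z)"
    (is "_ < _ * ?S")
proof -
  define a b c e where "a = dist x z" "b = dist y z" "c = dist w z" "e = dist y w"
  note defs = this
  have nn: "0 \<le> a" "0 \<le> b" "0 \<le> c" "0 \<le> e" by (simp_all add: defs)
  have dxy: "max a b \<le> inner_ball_distance x y z" and dxw: "max a c \<le> inner_ball_distance x w z"
    using max_dist_le_inner_ball_distance[OF xy] max_dist_le_inner_ball_distance[OF xw]
    by (simp_all add: defs)
  have D: "dist x y \<le> a + b" "0 < dist x y"
    using dist_triangle2[of x y z] assms(2) by (simp_all add: defs)
  have easy: ?thesis if "b \<le> inner_ball_distance y w z"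
    using that dxy dxw D by (intro less_constant_mult_of_three_halves) linarith+
  show ?thesis
  proof (cases "0 \<le> inner (y - w) (z - w)")
    case True
    from dist_le_inner_ball_distance[OF this] show ?thesis
      by (intro easy) (simp add: defs inner_ball_distance_swap23)
  next
    case False
    then have dyw: "max e c \<le> inner_ball_distance y w z"
      using max_dist_le_inner_ball_distance[of y w z]
      by (simp add: defs inner_ball_distance_swap23 dist_commute)
    let ?t = "max a b" and ?m = "max e c"
    \<comment> \<open>the only strict relation; it is what keeps the constant from being attained\<close>
    have "c\<^sup>2 + e\<^sup>2 < b\<^sup>2"
      using cosine_rule[of y z w] False by (simp add: defs dist_commute)
    also have "b\<^sup>2 \<le> ?t\<^sup>2" using nn by (intro power_mono) auto
    finally have lt: "(10 - sqrt 2) * ((a + c)\<^sup>2 + e\<^sup>2) < 4 * (?t + a + ?m)\<^sup>2"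
      using nn by (intro extremal_inequality) auto
    have "(dist x w)\<^sup>2 \<le> (a + c)\<^sup>2"
      using dist_triangle2[of x w z] by (intro power_mono) (simp_all add: defs)
    \<comment> \<open>the angle at \<open>w\<close> in \<open>xyw\<close> is not obtuse\<close>
    then have "(dist x y)\<^sup>2 \<le> (a + c)\<^sup>2 + e\<^sup>2"
      using cosine_rule[of x y w] assms(1) unfolding defs by linarith
    then have "(10 - sqrt 2) * (dist x y)\<^sup>2 \<le> (10 - sqrt 2) * ((a + c)\<^sup>2 + e\<^sup>2)"
      using sqrt_2_bounds by (intro mult_left_mono) auto
    also note lt
    also have "4 * (?t + a + ?m)\<^sup>2 \<le> 4 * ?S\<^sup>2"
      using dxy dxw dyw nn by (intro mult_left_mono power_mono add_mono) auto
    also have "4 * ?S\<^sup>2 = (10 - sqrt 2) * (inner_ball_constant * ?S)\<^sup>2"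
      unfolding inner_ball_constant_sq[symmetric] by algebra
    finally have "(dist x y)\<^sup>2 < (inner_ball_constant * ?S)\<^sup>2"
      using sqrt_2_bounds by (simp add: mult_less_cancel_left)
    moreover have "0 \<le> inner_ball_constant * ?S"
      using inner_ball_constant_bounds(1)
      by (intro mult_nonneg_nonneg add_nonneg_nonneg inner_ball_distance_nonneg) auto
    ultimately show ?thesis by (rule power2_less_imp_less)
  qed
qed

text \<open>In the first three cases one replaced triangle, or two of them together, contributes
  \<open>dist x y\<close>, and the rest at least half of it, because the distances satisfy the triangle
  inequality and every pair contributes at least half its own.  The last two cases are the critical
  configuration and its image under exchanging \<open>x\<close> and \<open>y\<close>.\<close>

lemma dist_less_constant_mult_sum:
  fixes x y w z :: "'a::euclidean_space"
  assumes "0 \<le> inner (x - w) (y - w)" "x \<noteq> y"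
  shows "dist x y < inner_ball_constant *
    (inner_ball_distance x y z + inner_ball_distance x w z + inner_ball_distance y w z)"
    (is "_ < _ * ?S")
proof -
  have pos: "0 < dist x y" using assms by simp
  note easy = less_constant_mult_of_three_halves[OF pos]
  have tri: "dist x y \<le> dist x w + dist y w" "dist x y \<le> dist x z + dist y z"
    by (rule dist_triangle2)+
  note half = half_dist_le_inner_ball_distance[of x y z] half_dist_le_inner_ball_distance[of x w z]
    half_dist_le_inner_ball_distance[of y w z]
  consider "0 \<le> inner (x - z) (y - z)"
    | "0 \<le> inner (x - z) (w - z)" "0 \<le> inner (y - z) (w - z)"
    | "inner (x - z) (w - z) \<le> 0" "inner (y - z) (w - z) \<le> 0"
    | "inner (x - z) (y - z) \<le> 0" "inner (x - z) (w - z) \<le> 0"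
    | "inner (x - z) (y - z) \<le> 0" "inner (y - z) (w - z) \<le> 0"
    by linarith
  then show ?thesis
  proof cases
    case 1
    from dist_le_inner_ball_distance[OF 1] show ?thesis
      by (intro easy) (use half tri in linarith)
  next
    case 2
    from 2[THEN dist_le_inner_ball_distance] show ?thesis
      by (intro easy) (use half tri in linarith)
  next
    case 3
    from 3[THEN max_dist_le_inner_ball_distance] show ?thesis
      by (intro easy) (use half tri in linarith)
  next
    case 4
    then show ?thesis using assms by (intro critical_case)
  next
    case 5
    then have "dist y x < inner_ball_constant *
      (inner_ball_distance y x z + inner_ball_distance y w z + inner_ball_distance x w z)"
      using assms inner_commute[of "x - w" "y - w"] inner_commute[of "x - z" "y - z"]
      by (intro critical_case) auto
    then show ?thesis
      unfolding dist_commute[of y x] inner_ball_distance_swap12[of y x] by (simp only: add_ac)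
  qed
qed

lemma inner_ball_distance_less_constant_mult_sum:
  fixes x y w z :: "'a::euclidean_space"
  assumes "\<not> (x = y \<and> y = w)"
  shows "inner_ball_distance x y w < inner_ball_constant *
    (inner_ball_distance z y w + inner_ball_distance x z w + inner_ball_distance x y z)"
proof -
  obtain a b where ab: "diametral {x, y, w} a b" and D: "inner_ball_distance x y w = dist a b"
    using assms by (rule inner_ball_distance_cases)
  have mem: "a \<noteq> b" "\<And>p. p \<in> {x, y, w} \<Longrightarrow> 0 \<le> inner (a - p) (b - p)"
    using ab by (auto simp: diametral_def)
  have main: "dist a b < inner_ball_constant *
    (inner_ball_distance a b z + inner_ball_distance a p z + inner_ball_distance b p z)"
    if "p \<in> {x, y, w}" for p
    using that mem by (intro dist_less_constant_mult_sum) auto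
  have eqs: "inner_ball_distance z y w = inner_ball_distance y w z"
    "inner_ball_distance x z w = inner_ball_distance x w z"
    "inner_ball_distance y x z = inner_ball_distance x y z"
    "inner_ball_distance w x z = inner_ball_distance x w z"
    "inner_ball_distance w y z = inner_ball_distance y w z"
    by (rule inner_ball_distance_cong; auto)+
  have "a \<in> {x, y, w}" "b \<in> {x, y, w}" using ab by (auto simp: diametral_def)
  then show ?thesis
    using main[of x] main[of y] main[of w] mem(1) unfolding D eqs
    by (elim insertE; simp add: eqs add_ac)
qed

lemma card_triple_ge_2_iff: "2 \<le> card {x, y, z} \<longleftrightarrow> \<not> (x = y \<and> y = z)"
  by (auto simp: card_insert_if)

lemma simplex_ratio_less:
  fixes x y w z :: "'a::euclidean_space"
  assumes "\<not> (x = y \<and> y = w)"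
  shows "simplex_ratio inner_ball_distance x y w z < inner_ball_constant"
proof -
  let ?S = "inner_ball_distance z y w + inner_ball_distance x z w + inner_ball_distance x y z"
  have lt: "inner_ball_distance x y w < inner_ball_constant * ?S"
    by (rule inner_ball_distance_less_constant_mult_sum[OF assms])
  then have "0 < inner_ball_constant * ?S"
    using inner_ball_distance_nonneg[of x y w] by linarith
  then have "0 < ?S" using inner_ball_constant_bounds(1) by (simp add: zero_less_mult_iff)
  then show ?thesis using lt by (simp add: simplex_ratio_def divide_less_eq)
qed

lemma inner_ball_distance_simplex_inequality:
  fixes x y w z :: "'a::euclidean_space"
  shows "inner_ball_distance x y w \<le>
    inner_ball_distance z y w + inner_ball_distance x z w + inner_ball_distance x y z"
    (is "_ \<le> ?S")
proof -
  have S: "0 \<le> ?S"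
    using inner_ball_distance_nonneg[of z y w] inner_ball_distance_nonneg[of x z w]
      inner_ball_distance_nonneg[of x y z] by linarith
  show ?thesis
  proof (cases "x = y \<and> y = w")
    case True
    then have "inner_ball_distance x y w = 0" by (simp only: inner_ball_distance_eq_0_iff)
    then show ?thesis using S by (simp only:)
  next
    case False
    have "inner_ball_distance x y w < inner_ball_constant * ?S"
      by (rule inner_ball_distance_less_constant_mult_sum[OF False])
    also have "\<dots> \<le> 1 * ?S"
      using S inner_ball_constant_bounds(2) by (intro mult_right_mono) simp_all
    finally show ?thesis by (simp only: mult_1_left less_imp_le)
  qed
qed

lemma three_distance_inner_ball_distance:
  "three_distance UNIV (inner_ball_distance :: 'a::euclidean_space \<Rightarrow> 'a \<Rightarrow> 'a \<Rightarrow> real)"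
proof -
  obtain u :: 'a where "u \<in> Basis" using nonempty_Basis by blast
  then have "u \<noteq> 0" by (rule nonzero_Basis)
  then have nontrivial: "\<exists>a\<in>UNIV. \<exists>b\<in>UNIV. a \<noteq> (b::'a)" by (intro bexI[of _ u] bexI[of _ 0] UNIV_I)
  have sym: "inner_ball_distance x z y = inner_ball_distance x y z"
    "inner_ball_distance y x z = inner_ball_distance x y z"
    "inner_ball_distance y z x = inner_ball_distance x y z"
    "inner_ball_distance z x y = inner_ball_distance x y z"
    "inner_ball_distance z y x = inner_ball_distance x y z" for x y z :: 'a
    by (rule inner_ball_distance_cong; fast)+
  show ?thesis
    unfolding three_distance_def
    by (intro conjI ballI nontrivial inner_ball_distance_nonneg inner_ball_distance_eq_0_iff
        sym inner_ball_distance_simplex_inequality)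
qed

section \<open>Sharpness\<close>

text \<open>In the plane spanned by \<open>u\<close> and \<open>v\<close>, the triangle has vertices
  \<open>(- sqrt 2, h)\<close>, \<open>(1, 1)\<close>, \<open>(1, h)\<close> and a right angle at the last one, and the fourth
  point is the origin.  As soon as \<open>h > 0\<close>, the origin sees the last vertex and \<open>(1, 1)\<close>
  in a triangle that is obtuse at \<open>(1, h)\<close>, so its longest side, close to \<open>sqrt 2\<close>, is
  replaced by its middle side, close to 1.\<close>

lemma ratio_near_extremal:
  fixes u v :: "'a::euclidean_space" and h :: real
  assumes uv: "inner u u = 1" "inner v v = 1" "inner u v = 0" and h: "0 < h" "h < 1"
  shows "sqrt ((1 + sqrt 2)\<^sup>2 + (1 - h)\<^sup>2) / (sqrt (1 + h\<^sup>2) + 2 * sqrt (2 + h\<^sup>2))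
    \<le> simplex_ratio inner_ball_distance (h *\<^sub>R v - sqrt 2 *\<^sub>R u) (u + v) (u + h *\<^sub>R v) 0"
proof -
  define x y w where "x = h *\<^sub>R v - sqrt 2 *\<^sub>R u" "y = u + v" "w = u + h *\<^sub>R v"
  note defs = this
  note inner_simps' = inner_add_left inner_add_right inner_diff_left inner_diff_right uv
    inner_commute[of v u]
  have s: "sqrt 2 * sqrt 2 = (2::real)" "1.4 < sqrt 2" using sqrt_2_bounds by auto
  have hh: "h * h < 1" using h mult_strict_mono[of h 1 h 1] by simp
  have nx: "norm x = sqrt (2 + h\<^sup>2)" and ny: "norm y = sqrt 2" and nw: "norm w = sqrt (1 + h\<^sup>2)"
    unfolding norm_eq_sqrt_inner defs
    by (simp_all add: inner_simps' power2_eq_square algebra_simps)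
  have dyw: "dist y w = 1 - h"
  proof -
    have "y - w = (1 - h) *\<^sub>R v" by (simp add: defs algebra_simps)
    then show ?thesis using h uv by (simp add: dist_norm norm_eq_sqrt_inner)
  qed
  have dxy: "dist x y = sqrt ((1 + sqrt 2)\<^sup>2 + (1 - h)\<^sup>2)"
    unfolding dist_norm norm_eq_sqrt_inner defs
    by (simp add: inner_simps' power2_eq_square algebra_simps)
  have "inner_ball_distance x y 0 = max (norm x) (norm y)"
    using inner_ball_distance_obtuse[of x 0 y] h s
    by (simp add: defs inner_simps')
  then have xy: "inner_ball_distance x y 0 = sqrt (2 + h\<^sup>2)"
    unfolding nx ny by (simp add: max_def)
  have "inner_ball_distance x w 0 = max (norm x) (norm w)"
    using inner_ball_distance_obtuse[of x 0 w] hh s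
    by (simp add: defs inner_simps')
  then have xw: "inner_ball_distance x 0 w = sqrt (2 + h\<^sup>2)"
    unfolding nx nw by (simp add: max_def inner_ball_distance_swap23)
  have "inner (y - w) (0 - w) < 0"
    using h by (simp add: defs inner_simps')
  then have "inner_ball_distance y 0 w = max (1 - h) (norm w)"
    using inner_ball_distance_obtuse[of y w 0] by (simp add: dyw)
  moreover have "1 - h \<le> norm w"
    unfolding nw using h by (intro real_le_rsqrt) (simp add: power2_eq_square algebra_simps)
  ultimately have yw: "inner_ball_distance 0 y w = sqrt (1 + h\<^sup>2)"
    by (simp add: nw inner_ball_distance_swap12)
  have "0 \<le> inner (x - w) (y - w)"
    using h s by (simp add: defs inner_simps' algebra_simps)
  from dist_le_inner_ball_distance[OF this]
  have "sqrt ((1 + sqrt 2)\<^sup>2 + (1 - h)\<^sup>2) \<le> inner_ball_distance x y w" by (simp add: dxy)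
  then show ?thesis
    unfolding simplex_ratio_def defs[symmetric] xy xw yw
    by (intro frac_le) (auto simp: add_pos_nonneg inner_ball_distance_nonneg)
qed

lemma ratio_limit:
  "((\<lambda>h. sqrt ((1 + sqrt 2)\<^sup>2 + (1 - h)\<^sup>2) / (sqrt (1 + h\<^sup>2) + 2 * sqrt (2 + h\<^sup>2)))
    \<longlongrightarrow> inner_ball_constant) (at_right 0)"
proof -
  have "sqrt ((1 + sqrt 2)\<^sup>2 + (1 - 0)\<^sup>2) / (sqrt (1 + 0\<^sup>2) + 2 * sqrt (2 + 0\<^sup>2)) = inner_ball_constant"
    (is "?q = _")
  proof -
    have "?q\<^sup>2 = (4 + 2 * sqrt 2) / (9 + 4 * sqrt 2)"
      using sqrt_2_bounds(2)
      by (simp add: power_divide power2_eq_square algebra_simps)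
    also have "\<dots> = (20 + 2 * sqrt 2) / 49"
    proof -
      have nz: "9 + 4 * sqrt 2 \<noteq> (0::real)" using sqrt_2_bounds(1) by linarith
      have eq: "(4 + 2 * sqrt 2) * 49 = (20 + 2 * sqrt 2) * (9 + 4 * sqrt (2::real))"
        using sqrt_2_bounds(2) by (simp add: algebra_simps)
      show ?thesis by (rule frac_eq_eq[THEN iffD2, OF nz _ eq]) simp
    qed
    also have "\<dots> = inner_ball_constant\<^sup>2"
      by (simp add: inner_ball_constant_def power_mult_distrib power_divide)
    finally show ?thesis
      by (rule power2_eq_imp_eq) (simp_all add: inner_ball_constant_def)
  qed
  moreover have "((\<lambda>h::real. sqrt ((1 + sqrt 2)\<^sup>2 + (1 - h)\<^sup>2) / (sqrt (1 + h\<^sup>2) + 2 * sqrt (2 + h\<^sup>2)))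
    \<longlongrightarrow> ?q) (at_right 0)"
    by (intro tendsto_intros) (simp add: add_pos_pos less_imp_neq[symmetric])
  ultimately show ?thesis by (simp only:)
qed

lemma best_constant_inner_ball_distance:
  assumes "2 \<le> DIM('a::euclidean_space)"
  shows "best_constant UNIV (inner_ball_distance :: 'a \<Rightarrow> 'a \<Rightarrow> 'a \<Rightarrow> real) = inner_ball_constant"
  unfolding best_constant_def
proof (rule cSup_eq)
  fix q assume "q \<in> {simplex_ratio inner_ball_distance x1 x2 x3 z | x1 x2 x3 (z::'a).
    x1 \<in> UNIV \<and> x2 \<in> UNIV \<and> x3 \<in> UNIV \<and> z \<in> UNIV \<and> card {x1, x2, x3} \<ge> 2}"
  then show "q \<le> inner_ball_constant"
    by (auto simp: card_triple_ge_2_iff intro: less_imp_le[OF simplex_ratio_less])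
next
  fix M
  assume M: "\<And>q. q \<in> {simplex_ratio inner_ball_distance x1 x2 x3 z | x1 x2 x3 (z::'a).
    x1 \<in> UNIV \<and> x2 \<in> UNIV \<and> x3 \<in> UNIV \<and> z \<in> UNIV \<and> card {x1, x2, x3} \<ge> 2} \<Longrightarrow> q \<le> M"
  obtain u v :: 'a where uv: "u \<in> Basis" "v \<in> Basis" "u \<noteq> v"
    using assms by (metis card_le_Suc0_iff_eq finite_Basis not_less_eq_eq numeral_2_eq_2)
  have "sqrt ((1 + sqrt 2)\<^sup>2 + (1 - h)\<^sup>2) / (sqrt (1 + h\<^sup>2) + 2 * sqrt (2 + h\<^sup>2)) \<le> M"
    if h: "0 < h" "h < 1" for h
  proof -
    have "inner (u + v) v \<noteq> inner (u + h *\<^sub>R v) v"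
      using h uv by (simp add: inner_add_left inner_Basis)
    then have "u + v \<noteq> u + h *\<^sub>R v" by metis
    then have "2 \<le> card {h *\<^sub>R v - sqrt 2 *\<^sub>R u, u + v, u + h *\<^sub>R v}"
      unfolding card_triple_ge_2_iff by (simp only: de_Morgan_conj simp_thms)
    then have "simplex_ratio inner_ball_distance (h *\<^sub>R v - sqrt 2 *\<^sub>R u) (u + v) (u + h *\<^sub>R v) 0 \<le> M"
      by (intro M) blast
    then show ?thesis
      using ratio_near_extremal[of u v h] uv h by (simp add: inner_Basis)
  qed
  then have "eventually (\<lambda>h. sqrt ((1 + sqrt 2)\<^sup>2 + (1 - h)\<^sup>2) /
      (sqrt (1 + h\<^sup>2) + 2 * sqrt (2 + h\<^sup>2)) \<le> M) (at_right 0)"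
    by (auto simp: eventually_at_right_field intro!: exI[of _ 1])
  then show "inner_ball_constant \<le> M"
    by (rule tendsto_upperbound[OF ratio_limit]) simp
qed

theorem proposition3p2:
  fixes d :: "real ^ 'n \<Rightarrow> real ^ 'n \<Rightarrow> real ^ 'n \<Rightarrow> real"
    and \<rho> :: real
  assumes "CARD('n) \<ge> 2"
    and "d = inner_ball_distance"
    and "\<rho> = (1 / 7) * sqrt (20 + 2 * sqrt 2)"
  shows "three_distance UNIV d \<and> best_constant UNIV d = \<rho> \<and> \<not> best_constant_attained UNIV d"
proof (intro conjI)
  have \<rho>: "\<rho> = inner_ball_constant" using assms(3) by (simp add: inner_ball_constant_def)
  show "three_distance UNIV d"
    unfolding assms(2) by (rule three_distance_inner_ball_distance)
  show best: "best_constant UNIV d = \<rho>"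
    unfolding assms(2) \<rho> using assms(1) by (intro best_constant_inner_ball_distance) simp
  show "\<not> best_constant_attained UNIV d"
  proof
    assume "best_constant_attained UNIV d"
    then obtain x y w z where "2 \<le> card {x, y, w}" and eq: "simplex_ratio d x y w z = \<rho>"
      unfolding best_constant_attained_def best by (elim bexE conjE)
    then have "simplex_ratio d x y w z < \<rho>"
      unfolding assms(2) \<rho> card_triple_ge_2_iff by (intro simplex_ratio_less)
    then show False by (simp only: eq less_irrefl)
  qed
qed

end
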